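(* Let $\Gamma=(G,v_0,\ell)$ be an $n$-person shortest path game that is edge-symmetric and positive (i.e. $G$ is symmetric and $\ell^i(e)>0$ for all players $i\in I$ and all moves $e\in E$). Then $\Gamma$ has a Nash equilibrium (in pure stationary strategies). Furthermore, $\Gamma$ has a terminal Nash equilibrium whenever $V_T$ is reachable from $v_0$, i.e. whenever $G$ contains a directed path from $v_0$ to some vertex of $V_T$.
   Context: **Shortest path games.** $G=(V,E)$ is a finite directed graph; vertices are positions, directed edges are moves. $I=\{1,\dots,n\}$ is the set of players. $V=V_1\cup\dots\cup V_n\cup V_T$ is a given partition of $V$, where $V_i$ is the set of positions controlled by player $i$ and $V_T\neq\emptyset$ is the set of terminal positions; terminals are exactly the positions with no outgoing edge. $v_0\in V\setminus V_T$ is the initial position. Each player $i$ has a length function $\ell^i:E\to\mathbb{R}$, and $\ell=(\ell^i\mid i\in I)$. A (pure stationary) strategy of player $i$ is a map $\sigma_i:V_i\to V$ with $(v,\sigma_i(v))\in E$ for all $v\in V_i$. A situation is a tuple $\sigma=(\sigma_i\mid i\in I)$ of strategies. The play $P(\sigma)$ is the directed walk starting at $v_0$ that from each position $v\in V_i$ moves to $\sigma_i(v)$; it either reaches a terminal and stops (terminal play), or repeats a position and then follows a cycle infinitely many times (infinite play). The effective cost of $\sigma$ for player $i$ is $\ell^i(\sigma)=\sum_{(u,v)\in P(\sigma)}\ell^i(u,v)$, the sum along the walk; when all lengths are positive, the cost of an infinite play is $+\infty$ and that of a terminal play is finite. All players minimize their effective cost. A situation $\sigma$ is a Nash equilibrium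 (NE) if $\ell^i(\sigma)\le\ell^i(\sigma')$ for every player $i$ and every situation $\sigma'$ that may differ from $\sigma$ only in the strategy of player $i$. It is a terminal NE if moreover $P(\sigma)$ is a terminal play. $G$ is symmetric if $(u,v)\in E$ whenever $(v,u)\in E$, except if $u\in V_T$. The length functions are not assumed symmetric: $\ell^i(u,v)\ne\ell^i(v,u)$ is allowed. *)

theory Defs
  imports
    "HOL-Library.Extended_Real"
    "HOL-Library.FuncSet"
    "HOL-Library.Disjoint_Sets"
    "Graph_Theory.Pair_Digraph"
begin

record 'v sp_game =
  game_graph :: "'v pair_pre_digraph"
  num_players :: nat
  controlled :: "nat \<Rightarrow> 'v set"
  terminals :: "'v set"
  initial :: 'v
  move_length :: "nat \<Rightarrow> 'v \<times> 'v \<Rightarrow> real"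

abbreviation players :: "'v sp_game \<Rightarrow> nat set" where
  "players \<Gamma> \<equiv> {1..num_players \<Gamma>}"

abbreviation positions :: "'v sp_game \<Rightarrow> 'v set" where
  "positions \<Gamma> \<equiv> pverts (game_graph \<Gamma>)"

abbreviation moves :: "'v sp_game \<Rightarrow> ('v \<times> 'v) set" where
  "moves \<Gamma> \<equiv> parcs (game_graph \<Gamma>)"

text \<open>Blocks of the partition may be empty: a player may control no position.\<close>

locale shortest_path_game =
  fixes \<Gamma> :: "'v sp_game"
  assumes finite_digraph: "pair_fin_digraph (game_graph \<Gamma>)"
    and controlled_disjoint: "disjoint_family_on (controlled \<Gamma>) (players \<Gamma>)"
    and controlled_nonterminal: "i \<in> players \<Gamma> \<Longrightarrow> controlled \<Gamma> i \<inter> terminals \<Gamma> = {}"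
    and partition: "(\<Union>i\<in>players \<Gamma>. controlled \<Gamma> i) \<union> terminals \<Gamma> = positions \<Gamma>"
    and terminals_nonempty: "terminals \<Gamma> \<noteq> {}"
    and terminals_iff: "v \<in> positions \<Gamma> \<Longrightarrow> v \<in> terminals \<Gamma> \<longleftrightarrow> (\<nexists>w. (v, w) \<in> moves \<Gamma>)"
    and initial_nonterminal: "initial \<Gamma> \<in> positions \<Gamma> - terminals \<Gamma>"

definition edge_symmetric :: "'v sp_game \<Rightarrow> bool" where
  "edge_symmetric \<Gamma> \<longleftrightarrow>
     (\<forall>u v. (v, u) \<in> moves \<Gamma> \<and> u \<notin> terminals \<Gamma> \<longrightarrow> (u, v) \<in> moves \<Gamma>)"

definition positive :: "'v sp_game \<Rightarrow> bool" where
  "positive \<Gamma> \<longleftrightarrow> (\<forall>i\<in>players \<Gamma>. \<forall>e\<in>moves \<Gamma>. move_length \<Gamma> i e > 0)"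

definition strategies :: "'v sp_game \<Rightarrow> nat \<Rightarrow> ('v \<Rightarrow> 'v) set" where
  "strategies \<Gamma> i = (\<Pi>\<^sub>E v\<in>controlled \<Gamma> i. {w. (v, w) \<in> moves \<Gamma>})"

definition situations :: "'v sp_game \<Rightarrow> (nat \<Rightarrow> 'v \<Rightarrow> 'v) set" where
  "situations \<Gamma> = (\<Pi>\<^sub>E i\<in>players \<Gamma>. strategies \<Gamma> i)"

definition owner :: "'v sp_game \<Rightarrow> 'v \<Rightarrow> nat" where
  "owner \<Gamma> v = (THE i. i \<in> players \<Gamma> \<and> v \<in> controlled \<Gamma> i)"

text \<open>
  A play is an infinite sequence of positions. A play that has stopped at a terminal is
  padded by repeating that terminal; the padding steps are not moves and cost nothing.
\<close>

primrec play :: "'v sp_game \<Rightarrow> (nat \<Rightarrow> 'v \<Rightarrow> 'v) \<Rightarrow> nat \<Rightarrow> 'v" where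
  "play \<Gamma> \<sigma> 0 = initial \<Gamma>"
| "play \<Gamma> \<sigma> (Suc k) =
     (let v = play \<Gamma> \<sigma> k in if v \<in> terminals \<Gamma> then v else \<sigma> (owner \<Gamma> v) v)"

definition terminal_play :: "'v sp_game \<Rightarrow> (nat \<Rightarrow> 'v \<Rightarrow> 'v) \<Rightarrow> bool" where
  "terminal_play \<Gamma> \<sigma> \<longleftrightarrow> (\<exists>k. play \<Gamma> \<sigma> k \<in> terminals \<Gamma>)"

text \<open>
  For nonnegative lengths the series always converges in the extended reals; for an
  infinite play with lengths of mixed sign it need not have a meaningful value.
\<close>

definition effective_cost :: "'v sp_game \<Rightarrow> nat \<Rightarrow> (nat \<Rightarrow> 'v \<Rightarrow> 'v) \<Rightarrow> ereal" where
  "effective_cost \<Gamma> i \<sigma> =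
     (\<Sum>k. if play \<Gamma> \<sigma> k \<in> terminals \<Gamma> then 0
          else ereal (move_length \<Gamma> i (play \<Gamma> \<sigma> k, play \<Gamma> \<sigma> (Suc k))))"

definition nash_equilibrium :: "'v sp_game \<Rightarrow> (nat \<Rightarrow> 'v \<Rightarrow> 'v) \<Rightarrow> bool" where
  "nash_equilibrium \<Gamma> \<sigma> \<longleftrightarrow> \<sigma> \<in> situations \<Gamma> \<and>
     (\<forall>i\<in>players \<Gamma>. \<forall>\<sigma>'\<in>situations \<Gamma>.
        (\<forall>j\<in>players \<Gamma>. j \<noteq> i \<longrightarrow> \<sigma>' j = \<sigma> j) \<longrightarrow>
        effective_cost \<Gamma> i \<sigma> \<le> effective_cost \<Gamma> i \<sigma>')"

definition terminal_nash_equilibrium :: "'v sp_game \<Rightarrow> (nat \<Rightarrow> 'v \<Rightarrow> 'v) \<Rightarrow> bool" where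
  "terminal_nash_equilibrium \<Gamma> \<sigma> \<longleftrightarrow> nash_equilibrium \<Gamma> \<sigma> \<and> terminal_play \<Gamma> \<sigma>"

definition terminals_reachable :: "'v sp_game \<Rightarrow> bool" where
  "terminals_reachable \<Gamma> \<longleftrightarrow>
     (\<exists>t\<in>terminals \<Gamma>. initial \<Gamma> \<rightarrow>\<^sup>*\<^bsub>with_proj (game_graph \<Gamma>)\<^esub> t)"

context shortest_path_game
begin

lemma owner_controls:
  assumes "v \<in> positions \<Gamma>" "v \<notin> terminals \<Gamma>"
  shows "owner \<Gamma> v \<in> players \<Gamma> \<and> v \<in> controlled \<Gamma> (owner \<Gamma> v)"
proof -
  from assms partition obtain i where i: "i \<in> players \<Gamma>" "v \<in> controlled \<Gamma> i"
    by blast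
  have "j = i" if "j \<in> players \<Gamma> \<and> v \<in> controlled \<Gamma> j" for j
    using i that controlled_disjoint unfolding disjoint_family_on_def by blast
  with i show ?thesis
    unfolding owner_def by (metis (mono_tags, lifting) theI)
qed

lemma situation_move:
  assumes "\<sigma> \<in> situations \<Gamma>" "v \<in> positions \<Gamma>" "v \<notin> terminals \<Gamma>"
  shows "(v, \<sigma> (owner \<Gamma> v) v) \<in> moves \<Gamma>"
  using owner_controls[OF assms(2,3)] assms(1)
  unfolding situations_def strategies_def by (auto simp: PiE_iff)

lemma play_in_positions:
  assumes "\<sigma> \<in> situations \<Gamma>"
  shows "play \<Gamma> \<sigma> k \<in> positions \<Gamma>"
proof (induction k)
  case 0
  show ?case using initial_nonterminal by simp
next
  case (Suc k)
  then show ?case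
    using situation_move[OF assms Suc] pair_wf_digraph.arc_snd_in_verts
      pair_fin_digraph.axioms(1)[OF finite_digraph]
    by (fastforce simp: Let_def)
qed

lemma play_move:
  assumes "\<sigma> \<in> situations \<Gamma>" "play \<Gamma> \<sigma> k \<notin> terminals \<Gamma>"
  shows "(play \<Gamma> \<sigma> k, play \<Gamma> \<sigma> (Suc k)) \<in> moves \<Gamma>"
  using situation_move[OF assms(1) play_in_positions[OF assms(1)] assms(2)] assms(2)
  by (simp add: Let_def)

lemma effective_cost_terminal_play:
  assumes "terminal_play \<Gamma> \<sigma>"
  shows "\<bar>effective_cost \<Gamma> i \<sigma>\<bar> \<noteq> \<infinity>"
proof -
  obtain k where k: "play \<Gamma> \<sigma> k \<in> terminals \<Gamma>"
    using assms unfolding terminal_play_def by blast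
  have stop: "play \<Gamma> \<sigma> j \<in> terminals \<Gamma>" if "j \<ge> k" for j
    using that by (induction j rule: dec_induct) (simp_all add: k)
  let ?f = "\<lambda>j. if play \<Gamma> \<sigma> j \<in> terminals \<Gamma> then 0
    else move_length \<Gamma> i (play \<Gamma> \<sigma> j, play \<Gamma> \<sigma> (Suc j))"
  have "effective_cost \<Gamma> i \<sigma> = (\<Sum>j. ereal (?f j))"
    unfolding effective_cost_def by (intro suminf_cong) simp
  also have "\<dots> = (\<Sum>j<k. ereal (?f j))"
    using stop by (intro suminf_finite) auto
  also have "\<dots> = ereal (\<Sum>j<k. ?f j)" by (simp only: sum_ereal)
  finally show ?thesis by simp
qed

lemma effective_cost_infinite_play:
  assumes "positive \<Gamma>" "i \<in> players \<Gamma>" "\<sigma> \<in> situations \<Gamma>" "\<not> terminal_play \<Gamma> \<sigma>"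
  shows "effective_cost \<Gamma> i \<sigma> = \<infinity>"
proof -
  let ?e = "\<lambda>k. (play \<Gamma> \<sigma> k, play \<Gamma> \<sigma> (Suc k))"
  let ?S = "move_length \<Gamma> i ` moves \<Gamma>"
  have e: "?e k \<in> moves \<Gamma>" for k
    using play_move[OF assms(3)] assms(4) unfolding terminal_play_def by blast
  have fin: "finite ?S"
    using pair_fin_digraph.pair_finite_arcs[OF finite_digraph] by simp
  have Mpos: "Min ?S > 0"
    using e[of 0] assms(1,2) fin unfolding positive_def by (subst Min_gr_iff) auto
  have le: "Min ?S \<le> move_length \<Gamma> i (?e k)" for k
    using e fin by (intro Min_le) auto
  have cost: "effective_cost \<Gamma> i \<sigma> = (\<Sum>k. ereal (move_length \<Gamma> i (?e k)))"
    using assms(4) unfolding effective_cost_def terminal_play_def by simp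
  have nn: "0 \<le> ereal (move_length \<Gamma> i (?e k))" for k
    using le[of k] Mpos by simp
  have "ereal r \<le> effective_cost \<Gamma> i \<sigma>" for r
  proof -
    obtain N :: nat where N: "r < real N * Min ?S"
      using reals_Archimedean3[OF Mpos] by blast
    have "real N * Min ?S \<le> (\<Sum>k<N. move_length \<Gamma> i (?e k))"
      using sum_mono[of "{..<N}" "\<lambda>_. Min ?S" "\<lambda>k. move_length \<Gamma> i (?e k)"] le by simp
    with N have "ereal r \<le> (\<Sum>k<N. ereal (move_length \<Gamma> i (?e k)))" by simp
    also have "\<dots> \<le> effective_cost \<Gamma> i \<sigma>"
      unfolding cost by (intro sum_le_suminf summable_ereal_pos nn) auto
    finally show ?thesis .
  qed
  then show ?thesis by (metis ereal_top)
qed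

end

end

theory Submission
  imports Defs
begin

text \<open>
  Group the nonterminal positions into regions, the connected pieces with a common owner. A
  shortest chain of regions leads from the initial position to a terminal; it is processed
  starting at the terminal. In each region of the chain the owner takes a path to the already
  chosen entry of the next region that is shortest for her own lengths, and the entry of the
  region is its best one among the positions adjacent to the preceding region. Every other
  nonterminal neighbour of the region retreats into it, which symmetry permits, to the adjacent
  position that is farthest from the exit. So a player who deviates from a region that she owns
  and steps to a foreign position off the path is sent back and gains nothing, and the next
  region can be entered for good only through its entry.
\<close>

section \<open>Shortest walks and costs along a fixed successor map\<close>

text \<open>Minimal lengths exist because positive lengths on a finite edge set are bounded away
  from 0, so only finitely many walk lengths lie below a given bound. Walks are used instead of
  paths since prefixing an edge then always stays admissible, which yields the Bellman equations
  directly.\<close>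

lemma shortest_walks_to_set:
  fixes l :: "'v \<times> 'v \<Rightarrow> real"
  assumes fin: "finite M"
    and pos: "\<forall>e\<in>M. l e > 0"
    and disj: "C \<inter> T = {}"
    and reach: "\<forall>v\<in>C. \<exists>t\<in>T. (v, t) \<in> (M \<inter> C \<times> (C \<union> T))\<^sup>*"
  shows "\<exists>s F.
    (\<forall>v\<in>C. (v, s v) \<in> M \<and> s v \<in> C \<union> T \<and> F v = l (v, s v) + F (s v)) \<and>
    (\<forall>v\<in>C. \<forall>w\<in>C \<union> T. (v, w) \<in> M \<longrightarrow> F v \<le> l (v, w) + F w) \<and>
    (\<forall>v. v \<notin> C \<longrightarrow> F v = 0)"
proof -
  let ?N = "M \<inter> C \<times> (C \<union> T)"
  \<comment> \<open>\<open>A n v\<close> is the set of lengths of walks with \<open>n\<close> edges from \<open>v\<close> through \<open>C\<close> to \<open>T\<close>.\<close>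
  define A :: "nat \<Rightarrow> 'v \<Rightarrow> real set" where
    "A = rec_nat (\<lambda>v. if v \<in> T then {0} else {})
      (\<lambda>_ B v. \<Union>w\<in>?N `` {v}. (+) (l (v, w)) ` B w)"
  have A0: "A 0 v = (if v \<in> T then {0} else {})" for v by (simp add: A_def)
  have AS: "A (Suc n) v = (\<Union>w\<in>?N `` {v}. (+) (l (v, w)) ` A n w)" for n v
    by (simp add: A_def)
  \<comment> \<open>The extra 1 keeps the minimum meaningful when there are no edges.\<close>
  define \<delta> where "\<delta> = Min (insert 1 (l ` M))"
  have \<delta>: "\<delta> > 0" "\<And>e. e \<in> M \<Longrightarrow> \<delta> \<le> l e"
    using fin pos by (auto simp: \<delta>_def)
  have finN: "finite (?N `` {v})" for v
    by (rule finite_subset[of _ "snd ` M"]) (use fin in force)+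
  have finA: "finite (A n v)" for n v
    by (induction n arbitrary: v) (auto simp: A0 AS intro: finN)
  have lowA: "real n * \<delta> \<le> c" if "c \<in> A n v" for n v c
    using that
  proof (induction n arbitrary: v c)
    case 0
    then show ?case by (auto simp: A0 split: if_splits)
  next
    case (Suc n)
    then obtain w c' where w: "(v, w) \<in> ?N" "c' \<in> A n w" "c = l (v, w) + c'"
      by (auto simp: AS)
    have "\<delta> \<le> l (v, w)" using w(1) \<delta>(2) by blast
    then show ?case using Suc.IH[OF w(2)] w(3) by (simp add: algebra_simps)
  qed
  define B where "B v = (\<Union>n. A n v)" for v
  have BS: "l (v, w) + c \<in> B v" if "(v, w) \<in> ?N" "c \<in> B w" for v w c
  proof -
    obtain n where "c \<in> A n w" using \<open>c \<in> B w\<close> by (auto simp: B_def)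
    then have "l (v, w) + c \<in> A (Suc n) v" using that(1) by (auto simp: AS)
    then show ?thesis by (auto simp: B_def)
  qed
  have ne: "B v \<noteq> {}" if v: "v \<in> C \<union> T" for v
  proof -
    have "\<exists>t\<in>T. (v, t) \<in> ?N\<^sup>*" using v reach by blast
    then obtain t where t: "t \<in> T" "(v, t) \<in> ?N\<^sup>*" by blast
    show ?thesis using t(2)
    proof (induction rule: converse_rtrancl_induct)
      case base
      have "0 \<in> A 0 t" using t(1) by (simp add: A0)
      then show ?case by (auto simp: B_def)
    next
      case (step y z)
      then show ?case using BS by blast
    qed
  qed
  have "\<exists>m\<in>B v. \<forall>c\<in>B v. m \<le> c" if v: "v \<in> C \<union> T" for v
  proof -
    obtain b where b: "b \<in> B v" using ne[OF v] by blast
    \<comment> \<open>A walk of length at most \<open>b\<close> has fewer than \<open>k\<close>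
      edges, so the minimum over the possibly infinite set \<open>B v\<close> is taken over a finite
      part of it.\<close>
    obtain k where k: "b < real k * \<delta>" using reals_Archimedean3[OF \<delta>(1)] by blast
    let ?K = "{c \<in> B v. c \<le> b}"
    have "?K \<subseteq> (\<Union>n<k. A n v)"
    proof
      fix c assume c: "c \<in> ?K"
      then obtain n where n: "c \<in> A n v" by (auto simp: B_def)
      have "real n * \<delta> < real k * \<delta>" using lowA[OF n] c k by simp
      then have "n < k" using \<delta>(1) by simp
      then show "c \<in> (\<Union>n<k. A n v)" using n by blast
    qed
    then have "finite ?K" using finA by (meson finite_UN finite_lessThan finite_subset)
    moreover have "b \<in> ?K" using b by simp
    ultimately have K: "Min ?K \<in> ?K" "\<forall>c\<in>?K. Min ?K \<le> c"
      using Min_in[of ?K] Min_le[of ?K] by (blast, simp)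
    have "Min ?K \<le> c" if "c \<in> B v" for c
      using K that by (cases "c \<le> b") auto
    then show ?thesis using K(1) by blast
  qed
  then obtain m where m: "\<And>v. v \<in> C \<union> T \<Longrightarrow> m v \<in> B v"
    "\<And>v c. v \<in> C \<union> T \<Longrightarrow> c \<in> B v \<Longrightarrow> m v \<le> c"
    by metis
  have mT: "m v = 0" if v: "v \<in> T" for v
  proof -
    have "0 \<in> B v" using A0[of v] v unfolding B_def by (metis UN_I UNIV_I singletonI)
    then have "m v \<le> 0" using m(2) v by blast
    moreover obtain n where "m v \<in> A n v" using m(1)[of v] v unfolding B_def by blast
    then have "0 \<le> m v" using lowA \<delta>(1) by (meson less_imp_le mult_nonneg_nonneg of_nat_0_le_iff order_trans)
    ultimately show ?thesis by simp
  qed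
  have le: "m v \<le> l (v, w) + m w" if "v \<in> C" "w \<in> C \<union> T" "(v, w) \<in> M" for v w
    using BS[of v w "m w"] m that by blast
  \<comment> \<open>As \<open>C\<close> and \<open>T\<close> are disjoint, an optimal walk from
    \<open>v\<close> has a first edge; by \<open>le\<close> the rest of it must be optimal
    too.\<close>
  have "\<exists>w. (v, w) \<in> M \<and> w \<in> C \<union> T \<and> m v = l (v, w) + m w" if v: "v \<in> C" for v
  proof -
    obtain n where n: "m v \<in> A n v" using m(1)[of v] v unfolding B_def by blast
    moreover have "n \<noteq> 0" using n v disj by (auto simp: A0 split: if_splits)
    ultimately obtain k where "m v \<in> A (Suc k) v" by (metis not0_implies_Suc)
    then obtain w c where w: "(v, w) \<in> ?N" "c \<in> A k w" "m v = l (v, w) + c"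
      by (auto simp: AS)
    have "m w \<le> c" using m(2)[of w c] w by (auto simp: B_def)
    then show ?thesis using le[of v w] w by force
  qed
  then obtain s where s: "\<And>v. v \<in> C \<Longrightarrow> (v, s v) \<in> M \<and> s v \<in> C \<union> T \<and> m v = l (v, s v) + m (s v)"
    by metis
  define F where "F v = (if v \<in> C then m v else 0)" for v
  have F: "F v = m v" if "v \<in> C \<union> T" for v using that mT by (auto simp: F_def)
  show ?thesis
  proof (intro exI conjI ballI allI impI)
    fix v assume v: "v \<in> C"
    show "(v, s v) \<in> M" "s v \<in> C \<union> T" "F v = l (v, s v) + F (s v)"
      using s[OF v] F v by simp_all
    show "F v \<le> l (v, w) + F w" if "w \<in> C \<union> T" "(v, w) \<in> M" for w
      using le[OF v that] F v that by simp
  qed (simp add: F_def)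
qed

text \<open>Following \<open>s\<close> strictly decreases \<open>F\<close>, so on the finite set
  \<open>C\<close> the cost recursion along \<open>s\<close> is well-founded. It is solved for all
  \<open>i\<close> at once, because every player pays different lengths on the paths that one player
  chooses.\<close>

lemma cost_to_go_exists:
  fixes F :: "'v \<Rightarrow> real" and l :: "'i \<Rightarrow> 'v \<times> 'v \<Rightarrow> real"
  assumes fin: "finite C"
    and decr: "\<forall>v\<in>C. F (s v) < F v"
  shows "\<exists>G. (\<forall>i. \<forall>v\<in>C. G i v = l i (v, s v) + G i (s v)) \<and> (\<forall>i v. v \<notin> C \<longrightarrow> G i v = 0) \<and>
    (\<forall>i v. (\<forall>u\<in>C. 0 \<le> l i (u, s u)) \<longrightarrow> 0 \<le> G i v)"
proof -
  \<comment> \<open>The order on real values is not well-founded; counting the positions of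
    \<open>C\<close> with smaller \<open>F\<close> gives a rank in the naturals.\<close>
  let ?r = "\<lambda>v. card {u \<in> C. F u < F v}"
  let ?R = "{(s v, v) | v. v \<in> C \<and> s v \<in> C}"
  have wf: "wf ?R"
  proof (rule wf_subset[OF wf_measure[of ?r]], clarsimp)
    fix v assume v: "v \<in> C" "s v \<in> C"
    then have "{u \<in> C. F u < F (s v)} \<subset> {u \<in> C. F u < F v}"
      using decr v(1) by force
    then show "?r (s v) < ?r v" using fin by (simp add: psubset_card_mono)
  qed
  let ?P = "\<lambda>i f v r. r = (if v \<in> C then l i (v, s v) + (if s v \<in> C then f (s v) else 0) else 0)"
  have "\<exists>f. \<forall>v. ?P i f v (f v)" for i
    by (rule dependent_wf_choice[OF wf]) auto
  then obtain G where G: "\<And>i v. ?P i (G i) v (G i v)" by metis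
  have out: "G i v = 0" if "v \<notin> C" for i v using G[of i v] that by simp
  have rec: "G i v = l i (v, s v) + G i (s v)" if "v \<in> C" for i v
    using G[of i v] that out[of "s v" i] by simp
  have nonneg: "0 \<le> G i v" if nn: "\<And>u. u \<in> C \<Longrightarrow> 0 \<le> l i (u, s u)" for i v
    using wf
  proof (induction v rule: wf_induct_rule)
    case (less v)
    show ?case
    proof (cases "v \<in> C \<and> s v \<in> C")
      case True
      then show ?thesis using less[of "s v"] rec[of v i] nn[of v] by fastforce
    next
      case False
      then show ?thesis using out[of v i] out[of "s v" i] rec[of v i] nn[of v] by fastforce
    qed
  qed
  show ?thesis
    by (intro exI[of _ G] conjI allI ballI impI rec out nonneg) auto
qed

section \<open>Basic facts on positive symmetric games\<close>

locale positive_symmetric_game = shortest_path_game +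
  assumes sym: "edge_symmetric \<Gamma>" and pos: "positive \<Gamma>"
begin

lemma move_ends:
  assumes "(v, w) \<in> moves \<Gamma>"
  shows "v \<in> positions \<Gamma>" "v \<notin> terminals \<Gamma>" "w \<in> positions \<Gamma>"
proof -
  interpret pair_fin_digraph "game_graph \<Gamma>" by (rule finite_digraph)
  show v: "v \<in> positions \<Gamma>" and "w \<in> positions \<Gamma>"
    using assms arc_fst_in_verts arc_snd_in_verts by fastforce+
  show "v \<notin> terminals \<Gamma>" using terminals_iff[OF v] assms by blast
qed

lemma nonterminal_move:
  "v \<in> positions \<Gamma> - terminals \<Gamma> \<Longrightarrow> \<exists>w. (v, w) \<in> moves \<Gamma>"
  using terminals_iff by blast

lemma reverse_move: "(v, w) \<in> moves \<Gamma> \<Longrightarrow> w \<notin> terminals \<Gamma> \<Longrightarrow> (w, v) \<in> moves \<Gamma>"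
  using sym unfolding edge_symmetric_def by blast

lemma length_pos: "i \<in> players \<Gamma> \<Longrightarrow> e \<in> moves \<Gamma> \<Longrightarrow> move_length \<Gamma> i e > 0"
  using pos unfolding positive_def by blast

lemma finite_moves: "finite (moves \<Gamma>)"
  using pair_fin_digraph.pair_finite_arcs[OF finite_digraph] .

lemma finite_positions: "finite (positions \<Gamma>)"
  using pair_fin_digraph.pair_finite_verts[OF finite_digraph] .

lemma terminals_subset: "terminals \<Gamma> \<subseteq> positions \<Gamma>"
  using partition by blast

text \<open>The summands of the effective cost as reals, so that partial sums can be estimated
  without extended arithmetic.\<close>

definition step_cost :: "nat \<Rightarrow> (nat \<Rightarrow> 'a \<Rightarrow> 'a) \<Rightarrow> nat \<Rightarrow> real" where
  "step_cost i \<sigma> k = (if play \<Gamma> \<sigma> k \<in> terminals \<Gamma> then 0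
     else move_length \<Gamma> i (play \<Gamma> \<sigma> k, play \<Gamma> \<sigma> (Suc k)))"

lemma effective_cost_eq: "effective_cost \<Gamma> i \<sigma> = (\<Sum>k. ereal (step_cost i \<sigma> k))"
  unfolding effective_cost_def step_cost_def by (intro suminf_cong) simp

lemma step_cost_nonneg:
  "i \<in> players \<Gamma> \<Longrightarrow> \<sigma> \<in> situations \<Gamma> \<Longrightarrow> 0 \<le> step_cost i \<sigma> k"
  using play_move[of \<sigma> k] length_pos[of i] unfolding step_cost_def by (auto intro: less_imp_le)

text \<open>A single successor map determines all strategies, as each nonterminal position has one
  owner; the restrictions make the result extensional.\<close>

definition situation_of :: "('a \<Rightarrow> 'a) \<Rightarrow> nat \<Rightarrow> 'a \<Rightarrow> 'a" where
  "situation_of \<tau> = (\<lambda>i\<in>players \<Gamma>. \<lambda>v\<in>controlled \<Gamma> i. \<tau> v)"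

lemma situation_of_in_situations:
  assumes "\<And>v. v \<in> positions \<Gamma> - terminals \<Gamma> \<Longrightarrow> (v, \<tau> v) \<in> moves \<Gamma>"
  shows "situation_of \<tau> \<in> situations \<Gamma>"
proof -
  have "(v, \<tau> v) \<in> moves \<Gamma>" if "i \<in> players \<Gamma>" "v \<in> controlled \<Gamma> i" for i v
  proof -
    have "v \<in> positions \<Gamma>" using that partition by blast
    moreover have "v \<notin> terminals \<Gamma>" using that(2) controlled_nonterminal[OF that(1)] by blast
    ultimately show ?thesis using assms by simp
  qed
  then show ?thesis unfolding situation_of_def situations_def strategies_def by auto
qed

lemma situation_of_owner:
  "v \<in> positions \<Gamma> \<Longrightarrow> v \<notin> terminals \<Gamma> \<Longrightarrow> situation_of \<tau> (owner \<Gamma> v) v = \<tau> v"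
  using owner_controls[of v] by (simp add: situation_of_def)

section \<open>Punishing partial equilibria\<close>

text \<open>
  The partial equilibrium built so far. From a position in \<open>T\<close> the play under \<open>\<tau>\<close> stays in \<open>S\<close>,
  and \<open>\<kappa> i\<close> is its remaining cost for player \<open>i\<close>, equal to \<open>q i\<close> on \<open>T\<close>. The potential \<open>\<phi> i\<close> bounds
  the remaining cost from below when player \<open>i\<close> deviates and the others follow \<open>\<tau>\<close>; \<open>R i\<close>
  is closed under such deviations. The bound \<open>\<phi> i \<le> q i\<close> is what keeps earlier estimates valid
  when a later region is put in front: moving back into it is never cheaper.
\<close>

definition punishing :: "('a \<Rightarrow> 'a) \<Rightarrow> 'a set \<Rightarrow> 'a set \<Rightarrow> (nat \<Rightarrow> 'a \<Rightarrow> real) \<Rightarrow> (nat \<Rightarrow> real) \<Rightarrow>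
    (nat \<Rightarrow> 'a set) \<Rightarrow> (nat \<Rightarrow> 'a \<Rightarrow> real) \<Rightarrow> bool" where
  "punishing \<tau> T S \<kappa> q R \<phi> \<longleftrightarrow>
     (\<forall>v\<in>positions \<Gamma> - terminals \<Gamma>. (v, \<tau> v) \<in> moves \<Gamma>) \<and>
     T \<subseteq> S \<and> (\<forall>v\<in>S - terminals \<Gamma>. \<tau> v \<in> S) \<and>
     (\<forall>i\<in>players \<Gamma>.
        (\<forall>v\<in>T. \<kappa> i v = q i \<and> v \<in> R i \<and> \<phi> i v = q i) \<and>
        (\<forall>v\<in>S. 0 \<le> \<kappa> i v) \<and>
        (\<forall>v\<in>S - terminals \<Gamma>. \<kappa> i v = move_length \<Gamma> i (v, \<tau> v) + \<kappa> i (\<tau> v)) \<and>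
        (\<forall>v\<in>R i. \<phi> i v \<le> q i) \<and>
        (\<forall>v\<in>R i \<inter> terminals \<Gamma>. \<phi> i v \<le> 0) \<and>
        (\<forall>v\<in>R i. \<forall>w. (v, w) \<in> moves \<Gamma> \<longrightarrow> owner \<Gamma> v = i \<or> w = \<tau> v \<longrightarrow>
           w \<in> R i \<and> \<phi> i v \<le> move_length \<Gamma> i (v, w) + \<phi> i w))"

lemma punishingD:
  assumes "punishing \<tau> T S \<kappa> q R \<phi>"
  shows "v \<in> positions \<Gamma> - terminals \<Gamma> \<Longrightarrow> (v, \<tau> v) \<in> moves \<Gamma>"
    and "T \<subseteq> S"
    and "v \<in> S - terminals \<Gamma> \<Longrightarrow> \<tau> v \<in> S"
    and "i \<in> players \<Gamma> \<Longrightarrow> v \<in> T \<Longrightarrow> \<kappa> i v = q i \<and> v \<in> R i \<and> \<phi> i v = q i"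
    and "i \<in> players \<Gamma> \<Longrightarrow> v \<in> S \<Longrightarrow> 0 \<le> \<kappa> i v"
    and "i \<in> players \<Gamma> \<Longrightarrow> v \<in> S - terminals \<Gamma> \<Longrightarrow>
      \<kappa> i v = move_length \<Gamma> i (v, \<tau> v) + \<kappa> i (\<tau> v)"
    and "i \<in> players \<Gamma> \<Longrightarrow> v \<in> R i \<Longrightarrow> \<phi> i v \<le> q i"
    and "i \<in> players \<Gamma> \<Longrightarrow> v \<in> R i \<inter> terminals \<Gamma> \<Longrightarrow> \<phi> i v \<le> 0"
    and "i \<in> players \<Gamma> \<Longrightarrow> v \<in> R i \<Longrightarrow> (v, w) \<in> moves \<Gamma> \<Longrightarrow> owner \<Gamma> v = i \<or> w = \<tau> v \<Longrightarrow>
      w \<in> R i \<and> \<phi> i v \<le> move_length \<Gamma> i (v, w) + \<phi> i w"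
  using assms unfolding punishing_def by blast+

text \<open>The number \<open>q i\<close> bounds the cost of the play from above, by telescoping
  \<open>\<kappa> i\<close>, and the cost of every deviation of player \<open>i\<close> from below,
  by telescoping \<open>\<phi> i\<close>.\<close>

lemma punishing_imp_terminal_nash:
  assumes pun: "punishing \<tau> {initial \<Gamma>} S \<kappa> q R \<phi>" and SP: "S \<subseteq> positions \<Gamma>"
  shows "terminal_nash_equilibrium \<Gamma> (situation_of \<tau>)"
proof -
  let ?\<sigma> = "situation_of \<tau>"
  note P = punishingD[OF pun]
  have sit: "?\<sigma> \<in> situations \<Gamma>" using P(1) by (rule situation_of_in_situations)
  have inS: "play \<Gamma> ?\<sigma> k \<in> S" for k
  proof (induction k)
    case (Suc k)
    have "play \<Gamma> ?\<sigma> k \<in> positions \<Gamma>" using Suc SP by blast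
    then show ?case using P(3)[of "play \<Gamma> ?\<sigma> k"] Suc situation_of_owner[of "play \<Gamma> ?\<sigma> k" \<tau>]
      by (simp add: Let_def)
  qed (use P(2) in simp)
  have \<tau>: "play \<Gamma> ?\<sigma> (Suc k) = \<tau> (play \<Gamma> ?\<sigma> k)" if "play \<Gamma> ?\<sigma> k \<notin> terminals \<Gamma>" for k
    using situation_of_owner[of "play \<Gamma> ?\<sigma> k" \<tau>] that subsetD[OF SP inS] by (simp add: Let_def)
  have upper: "effective_cost \<Gamma> i ?\<sigma> \<le> ereal (q i)" if i: "i \<in> players \<Gamma>" for i
  proof -
    \<comment> \<open>What is paid so far plus what remains never exceeds \<open>q i\<close>; since
      \<open>\<kappa>\<close> is nonnegative, all partial sums are bounded.\<close>
    have "(\<Sum>k<n. step_cost i ?\<sigma> k) + \<kappa> i (play \<Gamma> ?\<sigma> n) \<le> q i" for n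
    proof (induction n)
      case 0
      then show ?case using P(4)[OF i, of "initial \<Gamma>"] by simp
    next
      case (Suc n)
      show ?case
      proof (cases "play \<Gamma> ?\<sigma> n \<in> terminals \<Gamma>")
        case True
        then show ?thesis using Suc by (simp add: step_cost_def)
      next
        case False
        then have "\<kappa> i (play \<Gamma> ?\<sigma> n) = step_cost i ?\<sigma> n + \<kappa> i (play \<Gamma> ?\<sigma> (Suc n))"
          using P(6)[OF i, of "play \<Gamma> ?\<sigma> n"] inS[of n] \<tau>[OF False] by (simp add: step_cost_def del: play.simps)
        then show ?thesis using Suc by (simp del: play.simps)
      qed
    qed
    moreover have "0 \<le> \<kappa> i (play \<Gamma> ?\<sigma> n)" for n using P(5)[OF i inS] .
    ultimately have "(\<Sum>k<n. step_cost i ?\<sigma> k) \<le> q i" for n by (smt (verit))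
    then show ?thesis unfolding effective_cost_eq
      by (intro suminf_bound) (use step_cost_nonneg[OF i sit] in auto)
  qed
  have lower: "ereal (q i) \<le> effective_cost \<Gamma> i \<sigma>'"
    if i: "i \<in> players \<Gamma>" and s': "\<sigma>' \<in> situations \<Gamma>"
      and agree: "\<forall>j\<in>players \<Gamma>. j \<noteq> i \<longrightarrow> \<sigma>' j = ?\<sigma> j" for i \<sigma>'
  proof (cases "terminal_play \<Gamma> \<sigma>'")
    case False
    then show ?thesis using effective_cost_infinite_play[OF pos i s'] by simp
  next
    case True
    then obtain n where n: "play \<Gamma> \<sigma>' n \<in> terminals \<Gamma>" unfolding terminal_play_def by blast
    \<comment> \<open>At each position either player \<open>i\<close> moves or \<open>\<tau>\<close>
      is followed, so the deviating play never leaves \<open>R i\<close> and each step pays for the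
      drop of the potential.\<close>
    have inv: "play \<Gamma> \<sigma>' k \<in> R i \<and> q i \<le> (\<Sum>j<k. step_cost i \<sigma>' j) + \<phi> i (play \<Gamma> \<sigma>' k)" for k
    proof (induction k)
      case 0
      then show ?case using P(4)[OF i, of "initial \<Gamma>"] by simp
    next
      case (Suc k)
      let ?v = "play \<Gamma> \<sigma>' k" and ?w = "play \<Gamma> \<sigma>' (Suc k)"
      show ?case
      proof (cases "?v \<in> terminals \<Gamma>")
        case True
        then show ?thesis using Suc by (simp add: step_cost_def)
      next
        case False
        have vw: "(?v, ?w) \<in> moves \<Gamma>" using play_move[OF s' False] .
        have "owner \<Gamma> ?v = i \<or> ?w = \<tau> ?v"
          using agree owner_controls[OF move_ends(1,2)[OF vw]]
            situation_of_owner[OF move_ends(1,2)[OF vw], of \<tau>] False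
          by (auto simp: Let_def)
        then have "?w \<in> R i \<and> \<phi> i ?v \<le> move_length \<Gamma> i (?v, ?w) + \<phi> i ?w"
          using P(9)[OF i _ vw] Suc by blast
        then show ?thesis using Suc False by (simp add: step_cost_def del: play.simps)
      qed
    qed
    have "\<phi> i (play \<Gamma> \<sigma>' n) \<le> 0" using P(8)[OF i] n inv[of n] by blast
    then have "ereal (q i) \<le> (\<Sum>j<n. ereal (step_cost i \<sigma>' j))" using inv[of n] by simp
    also have "\<dots> \<le> effective_cost \<Gamma> i \<sigma>'" unfolding effective_cost_eq
      by (intro sum_le_suminf summable_ereal_pos) (use step_cost_nonneg[OF i s'] in auto)
    finally show ?thesis .
  qed
  have "nash_equilibrium \<Gamma> ?\<sigma>"
    unfolding nash_equilibrium_def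
  proof (intro conjI ballI impI sit)
    fix i \<sigma>' assume "i \<in> players \<Gamma>" "\<sigma>' \<in> situations \<Gamma>" "\<forall>j\<in>players \<Gamma>. j \<noteq> i \<longrightarrow> \<sigma>' j = ?\<sigma> j"
    then show "effective_cost \<Gamma> i ?\<sigma> \<le> effective_cost \<Gamma> i \<sigma>'"
      using upper[of i] lower[of i \<sigma>'] by (meson order_trans)
  qed
  moreover have "terminal_play \<Gamma> ?\<sigma>"
  proof (rule ccontr)
    \<comment> \<open>An infinite play would cost infinity, contradicting the finite bound
      \<open>q\<close>. The owner of the initial position is a player for whom to say so.\<close>
    assume nt: "\<not> terminal_play \<Gamma> ?\<sigma>"
    have o: "owner \<Gamma> (initial \<Gamma>) \<in> players \<Gamma>"
      using owner_controls[of "initial \<Gamma>"] initial_nonterminal by blast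
    show False using upper[OF o] effective_cost_infinite_play[OF pos o sit nt] by simp
  qed
  ultimately show ?thesis unfolding terminal_nash_equilibrium_def by blast
qed

section \<open>Putting one region in front\<close>

text \<open>
  One step of the construction: the region \<open>C\<close>, owned by \<open>j\<close>, is put in front of \<open>T\<close>. In the proof,
  \<open>F\<close> is the distance of \<open>j\<close> to \<open>T\<close> inside \<open>C\<close>, \<open>Z\<close> is the set of positions that retreat into \<open>C\<close>
  by \<open>r\<close>, and \<open>G0 i\<close> is what player \<open>i\<close> pays on the shortest paths of \<open>j\<close>.
\<close>

lemma punishing_extend:
  assumes pun: "punishing \<tau> T S \<kappa> q R \<phi>"
    and CP: "C \<subseteq> positions \<Gamma> - terminals \<Gamma>"
    and j: "j \<in> players \<Gamma>" and own: "\<And>v. v \<in> C \<Longrightarrow> owner \<Gamma> v = j"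
    and CS: "C \<inter> S = {}"
    and exits: "\<And>v w. v \<in> C \<Longrightarrow> (v, w) \<in> moves \<Gamma> \<Longrightarrow> w \<notin> C \<Longrightarrow>
      w \<in> T \<or> w \<notin> terminals \<Gamma> \<and> owner \<Gamma> w \<noteq> j"
    and SC: "S \<inter> moves \<Gamma> `` C \<subseteq> T"
    and reach: "\<And>v. v \<in> C \<Longrightarrow> \<exists>t\<in>T. (v, t) \<in> (moves \<Gamma> \<inter> C \<times> (C \<union> T))\<^sup>*"
    and E: "E \<subseteq> C" "E \<noteq> {}"
  obtains \<tau>' x S' \<kappa>' q' R' \<phi>' where
    "punishing \<tau>' {x} S' \<kappa>' q' R' \<phi>'" "S' \<subseteq> S \<union> C" "S' \<inter> E = {x}"
proof -
  let ?M = "moves \<Gamma>" and ?l = "move_length \<Gamma>"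
  note P = punishingD[OF pun]
  have CT: "C \<inter> T = {}" using P(2) CS by blast
  have finC: "finite C" using CP finite_positions finite_subset by blast
  obtain s F where
    s: "\<And>v. v \<in> C \<Longrightarrow> (v, s v) \<in> ?M \<and> s v \<in> C \<union> T \<and> F v = ?l j (v, s v) + F (s v)" and
    Fle: "\<And>v w. v \<in> C \<Longrightarrow> w \<in> C \<union> T \<Longrightarrow> (v, w) \<in> ?M \<Longrightarrow> F v \<le> ?l j (v, w) + F w" and
    F0: "\<And>v. v \<notin> C \<Longrightarrow> F v = 0"
    using shortest_walks_to_set[OF finite_moves _ CT, of "?l j"] length_pos[OF j] reach by blast
  have decr: "F (s v) < F v" if "v \<in> C" for v
    using s[OF that] length_pos[OF j, of "(v, s v)"] by simp
  obtain G0 where G0: "\<And>i v. v \<in> C \<Longrightarrow> G0 i v = ?l i (v, s v) + G0 i (s v)"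
    "\<And>i v. v \<notin> C \<Longrightarrow> G0 i v = 0"
    "\<And>i v. \<forall>u\<in>C. 0 \<le> ?l i (u, s u) \<Longrightarrow> 0 \<le> G0 i v"
    using cost_to_go_exists[OF finC, of F s ?l] decr by blast
  \<comment> \<open>Both functions obey the same recursion along \<open>s\<close>, so a
    counterexample of least \<open>F\<close> would have a successor that is a counterexample of
    smaller \<open>F\<close>.\<close>
  have Gj: "G0 j v = F v" if "v \<in> C" for v
  proof (rule ccontr)
    let ?B = "{v \<in> C. G0 j v \<noteq> F v}"
    assume "G0 j v \<noteq> F v"
    then have "?B \<noteq> {}" "finite ?B" using that finC by auto
    then obtain u where u: "u \<in> C" "G0 j u \<noteq> F u"
      and mn: "\<And>u'. u' \<in> C \<Longrightarrow> G0 j u' \<noteq> F u' \<Longrightarrow> F u \<le> F u'"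
      using ex_is_arg_min_if_finite[of ?B F] by (auto simp: is_arg_min_linorder)
    have "G0 j (s u) \<noteq> F (s u)" using u s[OF u(1)] G0(1)[OF u(1), of j] by auto
    then have "s u \<in> C" using G0(2) F0 by metis
    then show False using mn[of "s u"] \<open>G0 j (s u) \<noteq> F (s u)\<close> decr[OF u(1)] by simp
  qed
  have Gnn: "0 \<le> G0 i v" if "i \<in> players \<Gamma>" for i v
    by (rule G0(3)) (use s length_pos[OF that] in \<open>auto intro: less_imp_le\<close>)
  have "\<exists>x\<in>E. \<forall>y\<in>E. F x \<le> F y"
    using ex_is_arg_min_if_finite[of E F] E finite_subset[OF E(1) finC]
    by (auto simp: is_arg_min_linorder)
  then obtain x where x: "x \<in> E" "\<And>y. y \<in> E \<Longrightarrow> F x \<le> F y" by blast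
  have xC: "x \<in> C" using x E by blast
  define Z where "Z = ?M `` C - C - T - terminals \<Gamma>"
  \<comment> \<open>Symmetry provides a way back into \<open>C\<close>. Maximality of
    \<open>F\<close> ensures that an excursion through \<open>v\<close> never returns nearer to the
    exit than where it started.\<close>
  have "\<exists>z\<in>C. (v, z) \<in> ?M \<and> (\<forall>y\<in>C. (v, y) \<in> ?M \<longrightarrow> F y \<le> F z)" if "v \<in> Z" for v
  proof -
    let ?Y = "{y \<in> C. (v, y) \<in> ?M}"
    have "?Y \<noteq> {}" using that reverse_move unfolding Z_def by blast
    moreover have "finite ?Y" using finC by simp
    ultimately have "\<exists>z\<in>?Y. \<forall>y\<in>?Y. - F z \<le> - F y"
      using ex_is_arg_min_if_finite[of ?Y "\<lambda>y. - F y"] by (auto simp: is_arg_min_linorder)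
    then show ?thesis by auto
  qed
  then obtain r where "\<forall>v\<in>Z. r v \<in> C \<and> (v, r v) \<in> ?M \<and> (\<forall>y\<in>C. (v, y) \<in> ?M \<longrightarrow> F y \<le> F (r v))"
    using bchoice[of Z "\<lambda>v z. z \<in> C \<and> (v, z) \<in> ?M \<and> (\<forall>y\<in>C. (v, y) \<in> ?M \<longrightarrow> F y \<le> F z)"] by blast
  then have r: "\<And>v. v \<in> Z \<Longrightarrow> r v \<in> C \<and> (v, r v) \<in> ?M"
    "\<And>v y. v \<in> Z \<Longrightarrow> y \<in> C \<Longrightarrow> (v, y) \<in> ?M \<Longrightarrow> F y \<le> F (r v)"
    by blast+
  \<comment> \<open>Among the neighbours of \<open>C\<close> only those in \<open>T\<close> can lie
    in \<open>S\<close>, so redirecting \<open>Z\<close> leaves the old play on \<open>S\<close>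
    intact.\<close>
  have ZS: "Z \<inter> S = {}" using SC unfolding Z_def by blast
  have ZC: "Z \<inter> C = {}" unfolding Z_def by blast
  define \<tau>' where "\<tau>' v = (if v \<in> C then s v else if v \<in> Z then r v else \<tau> v)" for v
  \<comment> \<open>\<open>D\<close> contains the path from \<open>x\<close> along \<open>s\<close>,
    as \<open>F\<close> decreases on it, and by the minimal choice of \<open>x\<close> it contains
    no other position of \<open>E\<close>.\<close>
  define D where "D = {v \<in> C. v = x \<or> F v < F x}"
  define q' where "q' i = q i + G0 i x" for i
  define \<kappa>' where "\<kappa>' i v = (if v \<in> C then q i + G0 i v else \<kappa> i v)" for i v
  \<comment> \<open>The cap at \<open>q' i\<close> secures the bound
    \<open>\<phi>' i \<le> q' i\<close>, also at positions of \<open>C\<close> from which player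
    \<open>i\<close> pays more than from \<open>x\<close>. Lengths being positive, capping preserves
    the step inequalities.\<close>
  define \<chi> where "\<chi> i v = min (q' i) (q i + G0 i v)" for i v
  \<comment> \<open>Player \<open>i\<close> is not forced to retreat from an own position in
    \<open>Z\<close>, so none of these is added; those already in \<open>R i\<close> keep their old
    potential.\<close>
  define R' where "R' i = R i \<union> C \<union> {v \<in> Z. owner \<Gamma> v \<noteq> i}" for i
  define \<phi>' where "\<phi>' i v = (if v \<in> C then \<chi> i v else
    if v \<in> Z \<and> owner \<Gamma> v \<noteq> i then \<chi> i (r v) else \<phi> i v)" for i v
  have sD: "s v \<in> D \<union> T" if "v \<in> D" for v
    using that s[of v] decr[of v] unfolding D_def by auto
  have \<tau>S: "\<tau>' v = \<tau> v" if "v \<in> S" for v using that CS ZS by (auto simp: \<tau>'_def)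
  have \<kappa>S: "\<kappa>' i v = \<kappa> i v" if "v \<in> S" for i v using that CS by (auto simp: \<kappa>'_def)
  have qnn: "0 \<le> q i" if i: "i \<in> players \<Gamma>" for i
  proof -
    obtain t where t: "t \<in> T" using reach[OF xC] by blast
    then have "0 \<le> \<kappa> i t" using P(2) P(5)[OF i] by blast
    then show ?thesis using P(4)[OF i t] by simp
  qed
  have qq: "q i \<le> q' i" if "i \<in> players \<Gamma>" for i using Gnn[OF that] by (simp add: q'_def)
  have \<chi>: "q i \<le> \<chi> i v" "\<chi> i v \<le> q' i" if "i \<in> players \<Gamma>" for i v
    using Gnn[OF that, of v] qq[OF that] by (auto simp: \<chi>_def)
  have \<phi>'T: "\<phi>' i v = q i" if "i \<in> players \<Gamma>" "v \<in> T" for i v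
    using P(4)[OF that] that(2) CT by (auto simp: \<phi>'_def Z_def)
  \<comment> \<open>Wherever the potential changes, the new value is at least \<open>q i\<close> and
    hence at least every old potential on \<open>R i\<close>.\<close>
  have \<phi>'alt: "\<phi>' i v = \<phi> i v \<or> q i \<le> \<phi>' i v" if "i \<in> players \<Gamma>" for i v
    using \<chi>(1)[OF that] by (auto simp: \<phi>'_def)
  have moves': "(v, \<tau>' v) \<in> ?M" if "v \<in> positions \<Gamma> - terminals \<Gamma>" for v
    using P(1)[OF that] s[of v] r(1)[of v] by (simp add: \<tau>'_def)
  have "punishing \<tau>' {x} (S \<union> D) \<kappa>' q' R' \<phi>'"
    unfolding punishing_def
  proof (intro conjI ballI allI impI)
    show "(v, \<tau>' v) \<in> ?M" if "v \<in> positions \<Gamma> - terminals \<Gamma>" for v by (rule moves'[OF that])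
    show "{x} \<subseteq> S \<union> D" using xC by (auto simp: D_def)
    show "\<tau>' v \<in> S \<union> D" if v: "v \<in> S \<union> D - terminals \<Gamma>" for v
    proof (cases "v \<in> S")
      case True
      then show ?thesis using \<tau>S[OF True] P(3)[of v] v by auto
    next
      case False
      then have "v \<in> D" "v \<in> C" using v by (auto simp: D_def)
      then show ?thesis using sD[of v] P(2) by (auto simp: \<tau>'_def)
    qed
  next
    fix i assume i: "i \<in> players \<Gamma>"
    show "\<kappa>' i v = q' i" "v \<in> R' i" "\<phi>' i v = q' i" if "v \<in> {x}" for v
      using that xC Gnn[OF i, of x] by (auto simp: \<kappa>'_def q'_def R'_def \<phi>'_def \<chi>_def)
    show "0 \<le> \<kappa>' i v" if "v \<in> S \<union> D" for v
      using that P(5)[OF i, of v] qnn[OF i] Gnn[OF i, of v] by (auto simp: \<kappa>'_def D_def)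
    show "\<kappa>' i v = ?l i (v, \<tau>' v) + \<kappa>' i (\<tau>' v)" if v: "v \<in> S \<union> D - terminals \<Gamma>" for v
    proof (cases "v \<in> S")
      case True
      then have "\<tau> v \<in> S" using P(3) v by blast
      then show ?thesis using True P(6)[OF i, of v] v \<tau>S[OF True] \<kappa>S by simp
    next
      case False
      then have vD: "v \<in> D" and vC: "v \<in> C" using v by (auto simp: D_def)
      have "\<kappa>' i (s v) = q i + G0 i (s v)"
      proof (cases "s v \<in> C")
        case True
        then show ?thesis by (simp add: \<kappa>'_def)
      next
        case False
        then have "s v \<in> T" using s[OF vC] by blast
        then show ?thesis using False P(4)[OF i] G0(2) by (simp add: \<kappa>'_def)
      qed
      then show ?thesis using vC G0(1)[OF vC, of i] by (simp add: \<kappa>'_def \<tau>'_def)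
    qed
    show "\<phi>' i v \<le> q' i" if "v \<in> R' i" for v
      using that \<chi>(2)[OF i] P(7)[OF i, of v] qq[OF i] by (auto simp: \<phi>'_def R'_def)
    show "\<phi>' i v \<le> 0" if "v \<in> R' i \<inter> terminals \<Gamma>" for v
      using that P(8)[OF i, of v] CP by (auto simp: \<phi>'_def R'_def Z_def)
  next
    fix i v w
    assume i: "i \<in> players \<Gamma>" and vR: "v \<in> R' i" and vw: "(v, w) \<in> ?M"
      and c: "owner \<Gamma> v = i \<or> w = \<tau>' v"
    have lp: "0 < ?l i (v, w)" by (rule length_pos[OF i vw])
    consider (C_own) "v \<in> C" "i = j" | (C_other) "v \<in> C" "i \<noteq> j"
      | (Z_other) "v \<in> Z" "owner \<Gamma> v \<noteq> i" | (old) "v \<in> R i" "v \<notin> C" "v \<in> Z \<Longrightarrow> owner \<Gamma> v = i"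
      using vR by (auto simp: R'_def)
    then have "w \<in> R' i \<and> \<phi>' i v \<le> ?l i (v, w) + \<phi>' i w"
    proof cases
      case C_own
      have v: "\<phi>' i v = min (q' j) (q j + F v)" using C_own Gj by (simp add: \<phi>'_def \<chi>_def)
      consider "w \<in> C" | "w \<in> T" | "w \<in> Z" "owner \<Gamma> w \<noteq> j" "w \<notin> C"
        using exits[OF C_own(1) vw] vw C_own(1) by (auto simp: Z_def)
      then show ?thesis
      proof cases
        case 1
        then have "\<phi>' i w = min (q' j) (q j + F w)" using C_own Gj by (simp add: \<phi>'_def \<chi>_def)
        then show ?thesis using v 1 Fle[OF C_own(1) _ vw] lp C_own by (auto simp: R'_def)
      next
        case 2
        then have "w \<notin> C" using CT by blast
        then have "F v \<le> ?l j (v, w)" using Fle[OF C_own(1) _ vw] 2 F0[of w] by simp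
        then show ?thesis using v \<phi>'T[OF i 2] P(4)[OF i 2] C_own by (auto simp: R'_def)
      next
        case 3
        \<comment> \<open>The owner of \<open>C\<close> leaves to \<open>w\<close> and is sent back
          to \<open>r w\<close>. As \<open>v\<close> is itself a candidate for \<open>r w\<close>,
          the excursion costs a positive length and brings no progress.\<close>
        have "(w, v) \<in> ?M" using reverse_move[OF vw] 3 by (auto simp: Z_def)
        then have "F v \<le> F (r w)" using r(2)[of w v] 3 C_own by blast
        moreover have "\<phi>' i w = min (q' j) (q j + F (r w))"
          using 3 C_own r(1) Gj by (simp add: \<phi>'_def \<chi>_def)
        ultimately show ?thesis using v 3 C_own lp by (auto simp: R'_def)
      qed
    next
      case C_other
      then have w: "w = s v" using c own by (auto simp: \<tau>'_def)
      have v: "\<phi>' i v = \<chi> i v" using C_other by (simp add: \<phi>'_def)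
      have "q i + G0 i v = ?l i (v, w) + (q i + G0 i w)" using G0(1) C_other w by simp
      then have le: "\<phi>' i v \<le> ?l i (v, w) + \<chi> i w" using lp v by (auto simp: \<chi>_def)
      show ?thesis
      proof (cases "w \<in> C")
        case True
        then show ?thesis using le by (simp add: \<phi>'_def R'_def)
      next
        case False
        then have wT: "w \<in> T" using s C_other w by blast
        have "\<chi> i w \<le> q i" using False G0(2) by (simp add: \<chi>_def)
        then show ?thesis using le \<phi>'T[OF i wT] P(4)[OF i wT] by (auto simp: R'_def)
      qed
    next
      case Z_other
      then have "v \<notin> C" using ZC by blast
      then have "w = r v" using Z_other c by (simp add: \<tau>'_def)
      then have "w \<in> C" "\<phi>' i v = \<phi>' i w" using Z_other r(1) \<open>v \<notin> C\<close> by (auto simp: \<phi>'_def)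
      then show ?thesis using lp by (simp add: R'_def)
    next
      \<comment> \<open>Here \<open>\<tau>'\<close> can differ from \<open>\<tau>\<close> only where
        player \<open>i\<close> moves, so the old inequality applies and only the potential at the
        target may have changed.\<close>
      case old
      then have "owner \<Gamma> v = i \<or> w = \<tau> v" using c by (auto simp: \<tau>'_def split: if_splits)
      then have w: "w \<in> R i" "\<phi> i v \<le> ?l i (v, w) + \<phi> i w" using P(9)[OF i old(1) vw] by blast+
      have v: "\<phi>' i v = \<phi> i v" using old by (auto simp: \<phi>'_def)
      have "\<phi> i v \<le> q i" using P(7)[OF i old(1)] .
      then show ?thesis using w v \<phi>'alt[OF i, of w] lp by (auto simp: R'_def)
    qed
    then show "w \<in> R' i" "\<phi>' i v \<le> ?l i (v, w) + \<phi>' i w" by blast+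
  qed
  moreover have "S \<union> D \<subseteq> S \<union> C" by (auto simp: D_def)
  moreover have "(S \<union> D) \<inter> E = {x}"
    using x xC E CS by (force simp: D_def)
  ultimately show ?thesis by (rule that)
qed

section \<open>Regions and their distance to the terminals\<close>

definition same_owner_moves :: "'a rel" where
  "same_owner_moves = {(v, w) \<in> moves \<Gamma>. w \<notin> terminals \<Gamma> \<and> owner \<Gamma> v = owner \<Gamma> w}"

definition region :: "'a \<Rightarrow> 'a set" where
  "region v = same_owner_moves\<^sup>* `` {v}"

lemma self_in_region: "v \<in> region v" by (simp add: region_def)

lemma sym_same_owner_moves: "sym same_owner_moves"
  by (rule symI) (auto simp: same_owner_moves_def reverse_move dest: move_ends)

text \<open>By symmetry of the moves, reachability through positions of one owner is an equivalence,
  and the regions are its classes.\<close>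

lemma region_eq: "w \<in> region v \<Longrightarrow> region w = region v"
  using sym_rtrancl[OF sym_same_owner_moves] unfolding region_def
  by (auto dest: symD intro: rtrancl_trans)

lemma region_nonterminal:
  assumes "v \<in> positions \<Gamma> - terminals \<Gamma>" "w \<in> region v"
  shows "w \<in> positions \<Gamma> - terminals \<Gamma> \<and> owner \<Gamma> w = owner \<Gamma> v"
proof -
  have "(v, w) \<in> same_owner_moves\<^sup>*" using assms(2) by (simp add: region_def)
  then show ?thesis
    by (induction rule: rtrancl_induct) (use assms(1) move_ends in \<open>auto simp: same_owner_moves_def\<close>)
qed

lemma region_closed:
  assumes "w \<in> region v" "(w, u) \<in> moves \<Gamma>" "u \<notin> region v"
  shows "u \<in> terminals \<Gamma> \<or> owner \<Gamma> u \<noteq> owner \<Gamma> w"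
proof (rule ccontr)
  assume "\<not> ?thesis"
  then have "(w, u) \<in> same_owner_moves" using assms(2) by (simp add: same_owner_moves_def)
  then show False using assms(1,3) by (auto simp: region_def intro: rtrancl_into_rtrancl)
qed

text \<open>Supplies the reachability hypothesis of \<open>punishing_extend\<close>: walk inside the
  region to a predecessor of \<open>t\<close>, then leave.\<close>

lemma region_reaches_exit:
  assumes v: "v \<in> region v0" and t: "t \<in> T" "t \<in> moves \<Gamma> `` region v0"
  shows "(v, t) \<in> (moves \<Gamma> \<inter> region v0 \<times> (region v0 \<union> T))\<^sup>*"
proof -
  let ?N = "moves \<Gamma> \<inter> region v0 \<times> (region v0 \<union> T)"
  obtain y where y: "y \<in> region v0" "(y, t) \<in> moves \<Gamma>" using t(2) by blast
  have "(v, y) \<in> same_owner_moves\<^sup>*" using region_eq[OF v] y(1) by (auto simp: region_def)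
  then have "(v, y) \<in> ?N\<^sup>* \<and> y \<in> region v0"
  proof (induction rule: rtrancl_induct)
    case base
    show ?case using v by simp
  next
    case (step y z)
    then have "z \<in> region v0" by (auto simp: region_def)
    then have "(y, z) \<in> ?N" using step by (auto simp: same_owner_moves_def)
    then show ?case using step \<open>z \<in> region v0\<close> by (auto intro: rtrancl_into_rtrancl)
  qed
  moreover have "(y, t) \<in> ?N" using y t by blast
  ultimately show ?thesis by (auto intro: rtrancl_into_rtrancl)
qed

text \<open>Layers overlap; the distance of a position to the terminals is its least layer.\<close>

primrec layer :: "nat \<Rightarrow> 'a set" where
  "layer 0 = terminals \<Gamma>"
| "layer (Suc n) = {v \<in> positions \<Gamma> - terminals \<Gamma>. moves \<Gamma> `` region v \<inter> layer n \<noteq> {}}"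

lemma layer_subset: "layer n \<subseteq> positions \<Gamma>"
  using terminals_subset by (cases n) auto

lemma layer_region: "v \<in> layer (Suc n) \<Longrightarrow> w \<in> region v \<Longrightarrow> w \<in> layer (Suc n)"
  using region_nonterminal[of v w] region_eq[of w v] by auto

text \<open>At a terminal nothing remains to be paid, and no move leaves it, so the closure
  conditions are vacuous.\<close>

lemma punishing_base:
  "\<exists>\<tau>. punishing \<tau> (terminals \<Gamma>) (terminals \<Gamma>) (\<lambda>_ _. 0) (\<lambda>_. 0) (\<lambda>_. terminals \<Gamma>) (\<lambda>_ _. 0)"
proof -
  obtain \<tau> where "\<And>v. v \<in> positions \<Gamma> - terminals \<Gamma> \<Longrightarrow> (v, \<tau> v) \<in> moves \<Gamma>"
    using nonterminal_move by metis
  then show ?thesis unfolding punishing_def using move_ends(2) by (intro exI[of _ \<tau>]) auto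
qed

text \<open>Induction on the distance of the region to the terminals. The set \<open>E\<close> is
  arbitrary because the entry must be chosen among the neighbours of a preceding region that the
  induction hypothesis does not see; the bound on \<open>S\<close> keeps it disjoint from that
  region.\<close>

lemma punishing_region:
  assumes "v \<in> layer (Suc n)" "\<forall>k\<le>n. v \<notin> layer k" "E \<subseteq> region v" "E \<noteq> {}"
  shows "\<exists>x \<tau> S \<kappa> q R \<phi>. punishing \<tau> {x} S \<kappa> q R \<phi> \<and> S \<inter> E = {x} \<and>
    S \<subseteq> (\<Union>k\<le>n. layer k) \<union> region v"
  using assms
proof (induction n arbitrary: v E)
  case 0
  let ?C = "region v" and ?T = "terminals \<Gamma>"
  have vP: "v \<in> positions \<Gamma> - ?T" using 0 by simp
  note rn = region_nonterminal[OF vP]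
  have o: "owner \<Gamma> v \<in> players \<Gamma>" using owner_controls vP by blast
  obtain \<tau> where \<tau>: "punishing \<tau> ?T ?T (\<lambda>_ _. 0) (\<lambda>_. 0) (\<lambda>_. ?T) (\<lambda>_ _. 0)"
    using punishing_base by blast
  obtain t where t: "t \<in> ?T" "t \<in> moves \<Gamma> `` ?C" using 0(1) by auto
  have CP: "?C \<subseteq> positions \<Gamma> - ?T" and CS: "?C \<inter> ?T = {}" using rn by blast+
  have exits: "w \<in> ?T \<or> w \<notin> ?T \<and> owner \<Gamma> w \<noteq> owner \<Gamma> v"
    if "u \<in> ?C" "(u, w) \<in> moves \<Gamma>" "w \<notin> ?C" for u w
    using region_closed[OF that] rn[OF that(1)] by auto
  have reach: "\<exists>t\<in>?T. (u, t) \<in> (moves \<Gamma> \<inter> ?C \<times> (?C \<union> ?T))\<^sup>*" if "u \<in> ?C" for u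
    using region_reaches_exit[OF that t] t(1) by blast
  have own: "owner \<Gamma> u = owner \<Gamma> v" if "u \<in> ?C" for u using rn[OF that] by blast
  obtain \<tau>' x S' \<kappa>' q' R' \<phi>' where
    "punishing \<tau>' {x} S' \<kappa>' q' R' \<phi>'" "S' \<subseteq> ?T \<union> ?C" "S' \<inter> E = {x}"
    by (rule punishing_extend[OF \<tau> CP o own CS exits Int_lower1 reach 0(3,4)])
  moreover from this(2) have "S' \<subseteq> (\<Union>k\<le>0. layer k) \<union> ?C" by simp
  ultimately show ?case by blast
next
  case (Suc n)
  let ?C = "region v"
  have vP: "v \<in> positions \<Gamma> - terminals \<Gamma>" using Suc.prems by simp
  note rn = region_nonterminal[OF vP]
  have o: "owner \<Gamma> v \<in> players \<Gamma>" using owner_controls vP by blast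
  obtain u where u: "u \<in> layer (Suc n)" "u \<in> moves \<Gamma> `` ?C" using Suc.prems(1) by auto
  \<comment> \<open>A neighbour in a low layer would put \<open>v\<close> into a layer that
    minimality excludes. The case \<open>k = 0\<close> says that no exit of the region is
    terminal.\<close>
  have far: "w \<notin> layer k" if "w \<in> moves \<Gamma> `` ?C" "k \<le> n" for w k
  proof
    assume "w \<in> layer k"
    then have "v \<in> layer (Suc k)" using that(1) vP by auto
    then show False using Suc.prems(2) that(2) by (auto simp del: layer.simps)
  qed
  \<comment> \<open>Requiring the next entry to be adjacent to \<open>?C\<close> makes it reachable
    from there, and \<open>S \<inter> E' = {x}\<close> leaves \<open>x\<close> as the only neighbour
    of \<open>?C\<close> in \<open>S\<close>.\<close>
  define E' where "E' = region u \<inter> moves \<Gamma> `` ?C"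
  have E': "E' \<subseteq> region u" "E' \<noteq> {}" using u(2) self_in_region by (auto simp: E'_def)
  have "\<forall>k\<le>n. u \<notin> layer k" using far[OF u(2)] by blast
  then obtain x \<tau> S \<kappa> q R \<phi> where x: "punishing \<tau> {x} S \<kappa> q R \<phi>" "S \<inter> E' = {x}"
    "S \<subseteq> (\<Union>k\<le>n. layer k) \<union> region u"
    using Suc.IH[OF u(1) _ E'] by blast
  have SL: "S \<subseteq> (\<Union>k\<le>Suc n. layer k)"
  proof
    fix w assume "w \<in> S"
    then have "w \<in> (\<Union>k\<le>n. layer k) \<or> w \<in> layer (Suc n)"
      using x(3) layer_region[OF u(1)] by blast
    then show "w \<in> (\<Union>k\<le>Suc n. layer k)" by (auto simp del: layer.simps intro: le_SucI)
  qed
  have xC: "x \<in> moves \<Gamma> `` ?C" using x(2) by (auto simp: E'_def)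
  have CS: "?C \<inter> S = {}"
  proof -
    \<comment> \<open>A positive layer containing one position of \<open>?C\<close> would contain
      \<open>v\<close> too, since regions are classes.\<close>
    have "w \<notin> layer k" if w: "w \<in> ?C" and k: "k \<le> Suc n" for w k
    proof (cases k)
      case 0
      then show ?thesis using rn[OF w] by simp
    next
      case (Suc k')
      have "v \<in> region w" using region_eq[OF w] self_in_region by blast
      then show ?thesis
        using layer_region[of w k' v] Suc.prems(2) k \<open>k = Suc k'\<close> by blast
    qed
    then show ?thesis using SL by blast
  qed
  have CP: "?C \<subseteq> positions \<Gamma> - terminals \<Gamma>" using rn by blast
  have exits: "w \<in> {x} \<or> w \<notin> terminals \<Gamma> \<and> owner \<Gamma> w \<noteq> owner \<Gamma> v"
    if "y \<in> ?C" "(y, w) \<in> moves \<Gamma>" "w \<notin> ?C" for y w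
    using region_closed[OF that] rn[OF that(1)] far[of w 0] that by auto
  have SC: "S \<inter> moves \<Gamma> `` ?C \<subseteq> {x}"
    using x(2,3) far unfolding E'_def by blast
  have reach: "\<exists>t\<in>{x}. (y, t) \<in> (moves \<Gamma> \<inter> ?C \<times> (?C \<union> {x}))\<^sup>*" if "y \<in> ?C" for y
    using region_reaches_exit[OF that _ xC, of "{x}"] by blast
  have own: "owner \<Gamma> y = owner \<Gamma> v" if "y \<in> ?C" for y using rn[OF that] by blast
  obtain \<tau>' x' S' \<kappa>' q' R' \<phi>' where
    *: "punishing \<tau>' {x'} S' \<kappa>' q' R' \<phi>'" "S' \<subseteq> S \<union> ?C" "S' \<inter> E = {x'}"
    by (rule punishing_extend[OF x(1) CP o own CS exits SC reach Suc.prems(3,4)])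
  moreover have "S' \<subseteq> (\<Union>k\<le>Suc n. layer k) \<union> ?C" using *(2) SL by blast
  ultimately show ?case by blast
qed

section \<open>Existence of equilibria\<close>

lemma terminal_nash_equilibrium_exists:
  assumes "terminals_reachable \<Gamma>"
  shows "\<exists>\<sigma>. terminal_nash_equilibrium \<Gamma> \<sigma>"
proof -
  interpret pair_fin_digraph "game_graph \<Gamma>" by (rule finite_digraph)
  obtain t where t: "t \<in> terminals \<Gamma>" "(initial \<Gamma>, t) \<in> (moves \<Gamma>)\<^sup>*"
    using assms unfolding terminals_reachable_def reachable_def
    by (auto simp: arcs_ends_conv dest: rtrancl_on_rtranclI)
  from t(2) have "\<exists>n. initial \<Gamma> \<in> layer n"
  proof (induction rule: converse_rtrancl_induct)
    case base
    show ?case using t(1) by (intro exI[of _ 0]) simp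
  next
    case (step v w)
    then obtain n where "w \<in> layer n" by blast
    then have "w \<in> moves \<Gamma> `` region v \<inter> layer n" using step(1) self_in_region by blast
    then have "v \<in> layer (Suc n)" using move_ends[OF step(1)] by auto
    then show ?case by blast
  qed
  then obtain m where m: "initial \<Gamma> \<in> layer m" "\<forall>k<m. initial \<Gamma> \<notin> layer k"
    using exists_least_iff[of "\<lambda>n. initial \<Gamma> \<in> layer n"] by blast
  then obtain n where n: "m = Suc n" using initial_nonterminal by (cases m) auto
  have "initial \<Gamma> \<in> layer (Suc n)" "\<forall>k\<le>n. initial \<Gamma> \<notin> layer k"
    using m n by (simp_all only: less_Suc_eq_le)
  \<comment> \<open>Offering the initial position as the only candidate forces the entry of the last
    region to be the initial position.\<close>
  moreover have "{initial \<Gamma>} \<subseteq> region (initial \<Gamma>)" "{initial \<Gamma>} \<noteq> {}"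
    using self_in_region by auto
  ultimately obtain x \<tau> S \<kappa> q R \<phi> where x: "punishing \<tau> {x} S \<kappa> q R \<phi>" "S \<inter> {initial \<Gamma>} = {x}"
    "S \<subseteq> (\<Union>k\<le>n. layer k) \<union> region (initial \<Gamma>)"
    using punishing_region[of "initial \<Gamma>" n "{initial \<Gamma>}"] by blast
  have "x = initial \<Gamma>" using x(2) by blast
  moreover have "S \<subseteq> positions \<Gamma>"
    using x(3) layer_subset region_nonterminal[OF initial_nonterminal] by blast
  ultimately show ?thesis using punishing_imp_terminal_nash x(1) by blast
qed

text \<open>No play ends at a terminal, so every cost is infinite and any situation whatsoever is an
  equilibrium.\<close>

lemma nash_equilibrium_if_unreachable:
  assumes "\<not> terminals_reachable \<Gamma>"
  shows "\<exists>\<sigma>. nash_equilibrium \<Gamma> \<sigma>"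
proof -
  interpret pair_fin_digraph "game_graph \<Gamma>" by (rule finite_digraph)
  have inf: "\<not> terminal_play \<Gamma> \<sigma>" if \<sigma>: "\<sigma> \<in> situations \<Gamma>" for \<sigma>
  proof
    have r: "initial \<Gamma> \<rightarrow>\<^sup>*\<^bsub>with_proj (game_graph \<Gamma>)\<^esub> play \<Gamma> \<sigma> k" for k
    proof (induction k)
      case 0
      show ?case using initial_nonterminal by simp
    next
      case (Suc k)
      show ?case
      proof (cases "play \<Gamma> \<sigma> k \<in> terminals \<Gamma>")
        case True
        then show ?thesis using Suc by simp
      next
        case False
        then show ?thesis using Suc play_move[OF \<sigma> False]
          by (meson reachable_adj_trans in_arcs_imp_in_arcs_ends)
      qed
    qed
    assume "terminal_play \<Gamma> \<sigma>"
    then show False using assms r unfolding terminal_play_def terminals_reachable_def by blast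
  qed
  obtain \<tau> where "\<And>v. v \<in> positions \<Gamma> - terminals \<Gamma> \<Longrightarrow> (v, \<tau> v) \<in> moves \<Gamma>"
    using nonterminal_move by metis
  then have "situation_of \<tau> \<in> situations \<Gamma>" by (rule situation_of_in_situations)
  then show ?thesis using effective_cost_infinite_play[OF pos] inf
    unfolding nash_equilibrium_def by (metis order_refl)
qed

end

theorem theorem1:
  fixes \<Gamma> :: "'v sp_game"
  assumes "shortest_path_game \<Gamma>"
    and "edge_symmetric \<Gamma>"
    and "positive \<Gamma>"
  shows "(\<exists>\<sigma>. nash_equilibrium \<Gamma> \<sigma>) \<and>
    (terminals_reachable \<Gamma> \<longrightarrow> (\<exists>\<sigma>. terminal_nash_equilibrium \<Gamma> \<sigma>))"
proof -
  interpret positive_symmetric_game \<Gamma>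
    using assms by (simp add: positive_symmetric_game_def positive_symmetric_game_axioms_def)
  show ?thesis
    using terminal_nash_equilibrium_exists nash_equilibrium_if_unreachable
    unfolding terminal_nash_equilibrium_def by blast
qed

end
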